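(* Let $\lambda, x\in\mathbb{C}$. For every integer $n\ge 0$, every positive integer $d$ and every $k\in\mathbb{Z}$, \[ \beta_n^{(k)}(x\mid\lambda)=\sum_{a=0}^{d-1}\sum_{l=0}^{n}\sum_{p=1}^{l+1}\binom{n}{l}\frac{(-1)^{p+l+1}}{p^k}\,p!\,\frac{S_2(l+1,p)}{l+1}\,\beta_{n-l}\!\left(\frac{a+x}{d}\,\Big|\,\frac{\lambda}{d}\right)d^{\,n-l-1}. \]
   Context: All generating functions are formal power series in $t$. For $\lambda,x\in\mathbb{C}$ put $(x\mid\lambda)_0=1$ and $(x\mid\lambda)_n=x(x-\lambda)(x-2\lambda)\cdots(x-(n-1)\lambda)$ for $n\ge1$. The series $(1+\lambda t)^{x/\lambda}$ means $\sum_{m\ge0}(x\mid\lambda)_m\frac{t^m}{m!}$ (for $\lambda=0$, the limiting case, this is $e^{xt}$). For $k\in\mathbb{Z}$, $\mathrm{Li}_k(z)=\sum_{n=1}^\infty \frac{z^n}{n^k}$. The degenerate Bernoulli polynomials $\beta_n(x\mid\lambda)$ are defined by \[ \frac{t}{(1+\lambda t)^{1/\lambda}-1}(1+\lambda t)^{x/\lambda}=\sum_{n=0}^\infty \beta_n(x\mid\lambda)\frac{t^n}{n!}. \] The degenerate poly-Bernoulli polynomials $\beta_n^{(k)}(x\mid\lambda)$ are defined by \[ \frac{\mathrm{Li}_k(1-e^{-t})}{(1+\lambda t)^{1/\lambda}-1}(1+\lambda t)^{x/\lambda}=\sum_{n=0}^\infty \beta_n^{(k)}(x\mid\lambda)\frac{t^n}{n!}.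 \] $S_2(n,l)$ denotes the Stirling numbers of the second kind, given by $x^n=\sum_{l=0}^n S_2(n,l)\,x(x-1)\cdots(x-l+1)$. *)

theory Defs
  imports
    "HOL-Analysis.Analysis"
    "HOL-Computational_Algebra.Formal_Power_Series"
    "HOL-Combinatorics.Stirling"
begin

definition degenerate_ffact :: "complex \<Rightarrow> complex \<Rightarrow> nat \<Rightarrow> complex" where
  "degenerate_ffact l x n = (\<Prod>i<n. x - of_nat i * l)"

text \<open>
  The series \<open>(1 + l t) ^ (x / l)\<close>. The coefficient formula needs no division by \<open>l\<close>, so it
  also covers the limiting case \<open>l = 0\<close>.
\<close>

definition degenerate_exp :: "complex \<Rightarrow> complex \<Rightarrow> complex fps" where
  "degenerate_exp l x = Abs_fps (\<lambda>m. degenerate_ffact l x m / fact m)"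

lemma degenerate_exp_0: "degenerate_exp 0 x = fps_exp x"
  by (simp add: fps_eq_iff degenerate_exp_def degenerate_ffact_def)

text \<open>
  The case distinction is needed because \<open>1 / 0 powi k\<close> is \<open>1\<close> for \<open>k = 0\<close>, whereas the
  polylogarithm series starts at exponent \<open>1\<close> for all \<open>k\<close>.
\<close>

definition fps_polylog :: "int \<Rightarrow> complex fps" where
  "fps_polylog k = Abs_fps (\<lambda>n. if n = 0 then 0 else 1 / of_nat n powi k)"

definition degenerate_bernoulli :: "nat \<Rightarrow> complex \<Rightarrow> complex \<Rightarrow> complex" where
  "degenerate_bernoulli n x l =
     fact n * fps_nth (fps_X / (degenerate_exp l 1 - 1) * degenerate_exp l x) n"

definition degenerate_poly_bernoulli :: "int \<Rightarrow> nat \<Rightarrow> complex \<Rightarrow> complex \<Rightarrow> complex" where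
  "degenerate_poly_bernoulli k n x l =
     fact n * fps_nth ((fps_polylog k oo (1 - fps_exp (- 1))) / (degenerate_exp l 1 - 1)
                        * degenerate_exp l x) n"

text \<open>
  The denominator \<open>degenerate_exp l 1 - 1\<close> has subdegree \<open>1\<close> and both numerators have no
  constant term, so the divisions above are exact: the truncation built into division of
  formal power series discards nothing.
\<close>

lemma subdegree_degenerate_exp_minus_1: "subdegree (degenerate_exp l 1 - 1) = 1"
  by (rule subdegreeI) (simp_all add: degenerate_exp_def degenerate_ffact_def)

lemma degenerate_division_exact:
  assumes "fps_nth f 0 = 0"
  shows "f / (degenerate_exp l 1 - 1) * (degenerate_exp l 1 - 1) = f"
proof -
  have ne: "degenerate_exp l 1 - 1 \<noteq> 0"
    using subdegree_degenerate_exp_minus_1[of l] by auto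
  have "degenerate_exp l 1 - 1 dvd f"
  proof (cases "f = 0")
    case False
    have "subdegree f \<noteq> 0"
      using assms False nth_subdegree_nonzero by metis
    then show ?thesis
      unfolding fps_dvd_iff[OF ne False] subdegree_degenerate_exp_minus_1 by linarith
  qed simp
  then show ?thesis by simp
qed

lemma fps_polylog_compose_nth_0: "fps_nth (fps_polylog k oo (1 - fps_exp (- 1))) 0 = 0"
  by (simp add: fps_compose_nth fps_polylog_def)

lemma degenerate_bernoulli_egf:
  "fps_X / (degenerate_exp l 1 - 1) * degenerate_exp l x =
     Abs_fps (\<lambda>n. degenerate_bernoulli n x l / fact n)"
  by (simp add: fps_eq_iff degenerate_bernoulli_def)

lemma degenerate_poly_bernoulli_egf:
  "(fps_polylog k oo (1 - fps_exp (- 1))) / (degenerate_exp l 1 - 1) * degenerate_exp l x =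
     Abs_fps (\<lambda>n. degenerate_poly_bernoulli k n x l / fact n)"
  by (simp add: fps_eq_iff degenerate_poly_bernoulli_def)

text \<open>
  \<^const>\<open>Stirling\<close> is defined by its recurrence; it satisfies the expansion of monomials in
  falling factorials that characterises the numbers of the second kind.
\<close>

lemma power_eq_sum_Stirling:
  fixes x :: complex
  shows "x ^ n = (\<Sum>l\<le>n. of_nat (Stirling n l) * degenerate_ffact 1 x l)"
proof (induction n)
  case 0
  show ?case by (simp add: degenerate_ffact_def)
next
  case (Suc n)
  let ?f = "degenerate_ffact 1 x" and ?S = "\<lambda>n l. of_nat (Stirling n l) :: complex"
  have step: "x * ?f l = ?f (Suc l) + of_nat l * ?f l" for l
    by (simp add: degenerate_ffact_def algebra_simps)
  have shift: "(\<Sum>l\<le>n. of_nat l * ?S n l * ?f l)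
      = (\<Sum>l\<le>n. of_nat (Suc l) * ?S n (Suc l) * ?f (Suc l))"
  proof -
    have "(\<Sum>l\<le>n. of_nat l * ?S n l * ?f l) = (\<Sum>l\<le>Suc n. of_nat l * ?S n l * ?f l)"
      by simp
    also have "\<dots> = (\<Sum>l\<le>n. of_nat (Suc l) * ?S n (Suc l) * ?f (Suc l))"
      by (subst sum.atMost_Suc_shift) simp
    finally show ?thesis .
  qed
  have "x ^ Suc n = (\<Sum>l\<le>n. ?S n l * (x * ?f l))"
    by (simp add: Suc sum_distrib_left mult_ac)
  also have "\<dots> = (\<Sum>l\<le>n. ?S n l * ?f (Suc l)) + (\<Sum>l\<le>n. of_nat l * ?S n l * ?f l)"
    by (simp only: step sum.distrib[symmetric]) (simp add: algebra_simps)
  also have "\<dots> = (\<Sum>l\<le>n. ?S (Suc n) (Suc l) * ?f (Suc l))"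
    by (simp only: shift sum.distrib[symmetric]) (simp add: algebra_simps)
  also have "\<dots> = (\<Sum>l\<le>Suc n. ?S (Suc n) l * ?f l)"
    by (simp add: sum.atMost_Suc_shift del: sum.atMost_Suc Stirling.simps(4))
  finally show ?case .
qed

end

theory Submission
  imports Defs
begin

text \<open>
  Write \<open>E\<^sub>l(y)\<close> for the series \<open>(1 + l t) ^ (y / l)\<close>. The generating function of the degenerate
  poly-Bernoulli polynomials factors as
  \[ \frac{\mathrm{Li}_k(1 - e^{-t})}{t} \cdot \frac{t}{E_l(1) - 1}\, E_l(x), \]
  so \<open>\<beta>\<^sub>n\<^sup>(\<^sup>k\<^sup>)\<close> is a binomial convolution of the coefficients of the first factor with the
  degenerate Bernoulli polynomials \<open>\<beta>\<^sub>m(x | l)\<close>.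

  The coefficients of the first factor come from the exponential generating function of the
  Stirling numbers, which expands each power \<open>(1 - e\<^sup>-\<^sup>t) ^ p\<close> (lemma
  \<open>fps_polylog_compose_nth\<close>). The remaining sum over \<open>a\<close> is a multiplication theorem
  (lemma \<open>degenerate_bernoulli_multiplication\<close>): replacing \<open>t\<close> by \<open>d t\<close> turns \<open>E\<close> with parameter
  \<open>l / d\<close> and argument \<open>(a + x) / d\<close> into \<open>E\<^sub>l(a + x) = E\<^sub>l(x) E\<^sub>l(1) ^ a\<close>, and the geometric
  series over \<open>a\<close> converts the denominator \<open>E\<^sub>l(d) - 1\<close> into \<open>E\<^sub>l(1) - 1\<close>.
\<close>

unbundle no vec_syntax and fps_syntax

text \<open>For \<open>l \<noteq> 0\<close> this is Vandermonde's convolution for binomial series, rescaled.\<close>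

lemma degenerate_exp_add:
  "degenerate_exp l (x + y) = degenerate_exp l x * degenerate_exp l y"
proof (cases "l = 0")
  case True
  then show ?thesis
    by (simp add: degenerate_exp_0 fps_exp_add_mult)
next
  case False
  have binomial: "degenerate_exp l z = fps_binomial (z / l) oo (fps_const l * fps_X)" for z
  proof (rule fps_ext)
    fix n
    have "degenerate_ffact l z n = (\<Prod>i<n. l * (z / l - of_nat i))"
      unfolding degenerate_ffact_def using False by (intro prod.cong) (auto simp: field_simps)
    also have "\<dots> = l ^ n * (\<Prod>i<n. z / l - of_nat i)"
      by (simp add: prod.distrib)
    finally show "degenerate_exp l z $ n = (fps_binomial (z / l) oo (fps_const l * fps_X)) $ n"
      by (simp add: degenerate_exp_def gbinomial_prod_rev atLeast0LessThan)
  qed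
  show ?thesis
    unfolding binomial add_divide_distrib fps_binomial_add_mult
    by (intro fps_compose_mult_distrib) simp
qed

lemma degenerate_exp_of_nat: "degenerate_exp l (of_nat n) = degenerate_exp l 1 ^ n"
proof (induction n)
  case 0
  have "degenerate_ffact l 0 m = (if m = 0 then 1 else 0)" for m
    by (cases m) (auto simp: degenerate_ffact_def prod.lessThan_Suc_shift
        simp del: prod.lessThan_Suc)
  then show ?case
    by (simp add: fps_eq_iff degenerate_exp_def)
qed (simp add: degenerate_exp_add)

lemma degenerate_exp_compose_linear:
  "degenerate_exp l x oo (fps_const c * fps_X) = degenerate_exp (c * l) (c * x)"
proof (rule fps_ext)
  fix n
  have "degenerate_ffact (c * l) (c * x) n = (\<Prod>i<n. c * (x - of_nat i * l))"
    by (simp add: degenerate_ffact_def algebra_simps)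
  then show "(degenerate_exp l x oo (fps_const c * fps_X)) $ n
      = degenerate_exp (c * l) (c * x) $ n"
    by (simp add: degenerate_exp_def degenerate_ffact_def prod.distrib)
qed

text \<open>
  The factor \<open>d ^ m\<close> comes from substituting \<open>d t\<close> for \<open>t\<close>, after which all summands on the left
  share the denominator \<open>E\<^sub>l(d) - 1\<close>. Since \<open>E\<^sub>l(d) = E\<^sub>l(1) ^ d\<close>, this denominator is \<open>E\<^sub>l(1) - 1\<close>
  times the geometric sum that the numerators produce. The proof multiplies the
  generating functions of both sides by \<open>E\<^sub>l(d) - 1\<close>, which needs no division.
\<close>

lemma degenerate_bernoulli_multiplication:
  assumes "d \<ge> 1"
  shows "(\<Sum>a<d. of_nat d ^ m *
            degenerate_bernoulli m ((of_nat a + x) / of_nat d) (l / of_nat d))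
         = of_nat d * degenerate_bernoulli m x l"
proof -
  define c :: complex where "c = of_nat d"
  define E where "E = degenerate_exp l"
  define B where "B = (\<lambda>y l. fps_X / (degenerate_exp l 1 - 1) * degenerate_exp l y)"
  define S where "S = (\<Sum>a<d. B ((of_nat a + x) / c) (l / c) oo (fps_const c * fps_X))"
  have c: "c \<noteq> 0" using assms by (simp add: c_def)
  have B_times: "B y l * (degenerate_exp l 1 - 1) = fps_X * degenerate_exp l y" for y l
    unfolding B_def using degenerate_division_exact[of fps_X l] by (simp add: mult_ac)
  have geometric: "E c - 1 = (E 1 - 1) * (\<Sum>a<d. E (of_nat a))"
    by (simp add: E_def c_def degenerate_exp_of_nat power_diff_1_eq)
  have rescaled: "(B y (l / c) oo (fps_const c * fps_X)) * (E c - 1)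
      = fps_const c * fps_X * E (c * y)" for y
  proof -
    have "(B y (l / c) oo (fps_const c * fps_X)) * (E c - 1)
        = B y (l / c) * (degenerate_exp (l / c) 1 - 1) oo (fps_const c * fps_X)"
      using c by (simp add: fps_compose_mult_distrib fps_compose_sub_distrib
          degenerate_exp_compose_linear E_def)
    also have "\<dots> = fps_const c * fps_X * E (c * y)"
      unfolding B_times using c
      by (simp add: fps_compose_mult_distrib degenerate_exp_compose_linear E_def)
    finally show ?thesis .
  qed
  have "S * (E c - 1) = (\<Sum>a<d. fps_const c * fps_X * E (of_nat a + x))"
    unfolding S_def sum_distrib_right using c by (simp add: rescaled)
  also have "\<dots> = fps_const c * (fps_X * E x) * (\<Sum>a<d. E (of_nat a))"
    by (simp add: E_def degenerate_exp_add sum_distrib_left mult_ac)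
  also have "fps_X * E x = B x l * (E 1 - 1)"
    by (simp add: B_times E_def)
  also have "fps_const c * (B x l * (E 1 - 1)) * (\<Sum>a<d. E (of_nat a))
      = fps_const c * B x l * (E c - 1)"
    by (simp add: geometric mult_ac)
  finally have "S * (E c - 1) = fps_const c * B x l * (E c - 1)" .
  moreover have "(E c - 1) $ 1 \<noteq> 0"
    using c by (simp add: E_def degenerate_exp_def degenerate_ffact_def)
  then have "E c - 1 \<noteq> 0" by auto
  ultimately have "S = fps_const c * B x l" by simp
  then have "fact m * S $ m = fact m * (fps_const c * B x l) $ m" by simp
  moreover have "degenerate_bernoulli m y l = fact m * B y l $ m" for y l
    by (simp add: degenerate_bernoulli_def B_def)
  ultimately show ?thesis
    by (simp add: S_def fps_sum_nth sum_distrib_left c_def mult.left_commute)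
qed

text \<open>
  The derivative of \<open>(e\<^sup>c\<^sup>t - 1) ^ (p + 1)\<close> is \<open>c (p + 1) ((e\<^sup>c\<^sup>t - 1) ^ p + (e\<^sup>c\<^sup>t - 1) ^ (p + 1))\<close>, and
  comparing coefficients gives the recurrence of the Stirling numbers.
\<close>

lemma Stirling_egf:
  fixes c :: "'a :: field_char_0"
  shows "(fps_exp c - 1) ^ p $ m = c ^ m * fact p * of_nat (Stirling m p) / fact m"
proof (induction m arbitrary: p)
  case 0
  show ?case by (cases p) simp_all
next
  case (Suc m)
  show ?case
  proof (cases p)
    case 0
    then show ?thesis by simp
  next
    case (Suc q)
    let ?f = "fps_exp c - 1 :: 'a fps"
    have "fps_deriv (?f ^ Suc q) = of_nat (Suc q) * fps_deriv ?f * ?f ^ q"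
      by (simp only: fps_deriv_power' diff_Suc_1)
    also have "fps_deriv ?f = fps_const c * (1 + ?f)"
      by simp
    also have "of_nat (Suc q) * (fps_const c * (1 + ?f)) * ?f ^ q
        = fps_const (c * of_nat (Suc q)) * (?f ^ q + ?f ^ Suc q)"
      unfolding fps_const_mult[symmetric] fps_of_nat by (simp only: power_Suc) algebra
    finally have "fps_deriv (?f ^ Suc q)
        = fps_const (c * of_nat (Suc q)) * (?f ^ q + ?f ^ Suc q)" .
    then have "of_nat (Suc m) * ?f ^ Suc q $ Suc m
        = c * of_nat (Suc q) * (?f ^ q $ m + ?f ^ Suc q $ m)"
      by (metis fps_add_nth fps_deriv_nth fps_mult_left_const_nth Suc_eq_plus1)
    also have "\<dots> = c ^ Suc m * fact (Suc q) * of_nat (Stirling (Suc m) (Suc q)) / fact m"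
      unfolding Suc.IH by (simp add: field_simps)
    also have "\<dots> = of_nat (Suc m) *
        (c ^ Suc m * fact (Suc q) * of_nat (Stirling (Suc m) (Suc q)) / fact (Suc m))"
      by (simp only: fact_Suc times_divide_eq_right mult_divide_mult_cancel_left[OF of_nat_neq_0])
    finally show ?thesis
      unfolding \<open>p = Suc q\<close> by (metis mult_left_cancel of_nat_neq_0)
  qed
qed

text \<open>
  In the sign, \<open>(- 1) ^ p\<close> comes from \<open>1 - e\<^sup>-\<^sup>t = - (e\<^sup>-\<^sup>t - 1)\<close>, and \<open>(- 1) ^ m\<close> from the
  substitution of \<open>- t\<close> in the generating function of the Stirling numbers.
\<close>

lemma fps_polylog_compose_nth:
  "(fps_polylog k oo (1 - fps_exp (- 1))) $ m
     = (\<Sum>p = 1..m. (- 1) ^ (p + m) / of_nat p powi k * fact p * of_nat (Stirling m p)) / fact m"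
proof -
  have flip: "(1 - fps_exp (- 1)) ^ p = fps_const ((- 1) ^ p) * (fps_exp (- 1) - 1 :: complex fps) ^ p"
    for p :: nat
  proof -
    have "1 - fps_exp (- 1) = fps_const (- 1) * (fps_exp (- 1) - 1 :: complex fps)"
      by (simp flip: fps_const_neg)
    then show ?thesis
      by (simp only: power_mult_distrib fps_const_power)
  qed
  have "(fps_polylog k oo (1 - fps_exp (- 1))) $ m
      = (\<Sum>p = 0..m. fps_polylog k $ p * (1 - fps_exp (- 1)) ^ p $ m)"
    by (simp add: fps_compose_nth)
  also have "\<dots> = (\<Sum>p = 1..m. fps_polylog k $ p * (1 - fps_exp (- 1)) ^ p $ m)"
    by (simp add: sum.atLeast_Suc_atMost fps_polylog_def)
  also have "\<dots> = (\<Sum>p = 1..m.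
      (- 1) ^ (p + m) / of_nat p powi k * fact p * of_nat (Stirling m p) / fact m)"
    by (intro sum.cong) (auto simp: fps_polylog_def flip Stirling_egf power_add)
  finally show ?thesis
    by (simp add: sum_divide_distrib)
qed

text \<open>
  The polylogarithm series has no constant term, so it is \<open>t\<close> times its shift; this \<open>t\<close> is the
  numerator of the degenerate Bernoulli series. The shift is why the coefficient of index
  \<open>Suc i\<close> appears.
\<close>

lemma degenerate_poly_bernoulli_convolution:
  "degenerate_poly_bernoulli k n x l =
     (\<Sum>i = 0..n. of_nat (n choose i) *
        (fact i * (fps_polylog k oo (1 - fps_exp (- 1))) $ Suc i) *
        degenerate_bernoulli (n - i) x l)"
proof -
  let ?P = "fps_polylog k oo (1 - fps_exp (- 1))" and ?D = "degenerate_exp l 1 - 1"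
  have D: "?D \<noteq> 0"
    using subdegree_degenerate_exp_minus_1[of l] by auto
  have P: "?P = fps_shift 1 ?P * fps_X"
    using fps_polylog_compose_nth_0[of k] by (simp add: fps_eq_iff del: fps_compose_nth_0)
  have "fps_shift 1 ?P * (fps_X / ?D) * ?D = ?P"
    using degenerate_division_exact[of fps_X l] P by (simp add: mult.assoc)
  \<comment> \<open>Division of power series truncates, so moving the shift out of the quotient relies on
    both divisions being exact.\<close>
  then have quotient: "?P / ?D = fps_shift 1 ?P * (fps_X / ?D)"
    using D by (metis nonzero_mult_div_cancel_right)
  have "degenerate_poly_bernoulli k n x l
      = fact n * (fps_shift 1 ?P * (fps_X / ?D * degenerate_exp l x)) $ n"
    unfolding degenerate_poly_bernoulli_def quotient by (simp add: mult.assoc)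
  also have "\<dots> = (\<Sum>i = 0..n. fact n * (?P $ Suc i *
      (degenerate_bernoulli (n - i) x l / fact (n - i))))"
    unfolding degenerate_bernoulli_egf by (simp add: fps_mult_nth sum_distrib_left)
  also have "\<dots> = (\<Sum>i = 0..n. of_nat (n choose i) * (fact i * ?P $ Suc i) *
      degenerate_bernoulli (n - i) x l)"
    by (intro sum.cong) (auto simp: binomial_fact field_simps)
  finally show ?thesis .
qed

theorem theorem2p4:
  fixes lam x :: complex and n d :: nat and k :: int
  assumes "d \<ge> 1"
  shows "degenerate_poly_bernoulli k n x lam =
    (\<Sum>a = 0..<d. \<Sum>l = 0..n. \<Sum>p = 1..l + 1.
      of_nat (n choose l) * ((- 1) ^ (p + l + 1) / of_nat p powi k) * fact p
      * (of_nat (Stirling (l + 1) p) / of_nat (l + 1))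
      * degenerate_bernoulli (n - l) ((of_nat a + x) / of_nat d) (lam / of_nat d)
      * of_nat d powi (int n - int l - 1))"
proof -
  define b where
    "b = (\<lambda>a m. degenerate_bernoulli m ((of_nat a + x) / of_nat d) (lam / of_nat d))"
  define s where "s = (\<lambda>l p. (- 1) ^ (p + l + 1) / of_nat p powi k * fact p
    * of_nat (Stirling (l + 1) p) :: complex)"
  have d: "of_nat d \<noteq> (0 :: complex)" using assms by simp
  have bernoulli: "degenerate_bernoulli m x lam
      = (\<Sum>a = 0..<d. b a m * (of_nat d ^ m / of_nat d))" for m
    using degenerate_bernoulli_multiplication[OF assms, of m x lam] d
    by (simp add: b_def field_simps atLeast0LessThan flip: sum_divide_distrib)
  have polylog: "fact l * (fps_polylog k oo (1 - fps_exp (- 1))) $ Suc l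
      = (\<Sum>p = 1..l + 1. s l p / of_nat (l + 1))" for l
    unfolding fps_polylog_compose_nth s_def sum_divide_distrib sum_distrib_left
    by (intro sum.cong) (auto simp: divide_simps)
  have power: "of_nat d powi (int n - int l - 1) = of_nat d ^ (n - l) / (of_nat d :: complex)"
    if "l \<le> n" for l
    using d that by (simp add: power_int_diff power_diff)
  have "degenerate_poly_bernoulli k n x lam =
      (\<Sum>l = 0..n. of_nat (n choose l) * (\<Sum>p = 1..l + 1. s l p / of_nat (l + 1))
        * (\<Sum>a = 0..<d. b a (n - l) * (of_nat d ^ (n - l) / of_nat d)))"
    unfolding degenerate_poly_bernoulli_convolution polylog bernoulli ..
  also have "\<dots> = (\<Sum>l = 0..n. \<Sum>a = 0..<d. \<Sum>p = 1..l + 1.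
      of_nat (n choose l) * (s l p / of_nat (l + 1)) * b a (n - l)
        * (of_nat d ^ (n - l) / of_nat d))"
    by (simp only: sum_distrib_left sum_distrib_right mult.assoc)
  also have "\<dots> = (\<Sum>a = 0..<d. \<Sum>l = 0..n. \<Sum>p = 1..l + 1.
      of_nat (n choose l) * (s l p / of_nat (l + 1)) * b a (n - l)
        * (of_nat d ^ (n - l) / of_nat d))"
    by (rule sum.swap)
  also have "\<dots> = (\<Sum>a = 0..<d. \<Sum>l = 0..n. \<Sum>p = 1..l + 1.
      of_nat (n choose l) * ((- 1) ^ (p + l + 1) / of_nat p powi k) * fact p
      * (of_nat (Stirling (l + 1) p) / of_nat (l + 1))
      * b a (n - l) * of_nat d powi (int n - int l - 1))"
    by (intro sum.cong) (simp_all add: s_def power mult_ac)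
  finally show ?thesis
    unfolding b_def .
qed

end
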